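(* Let $(H;(\cdot,\cdot))$ be an inner product space over $\mathbb{K}$, where $\mathbb{K}=\mathbb{R}$ or $\mathbb{K}=\mathbb{C}$, let $n\ge 1$, let $x,y_1,\dots,y_n\in H$ and $c_1,\dots,c_n\in\mathbb{K}$. Let $\alpha,\beta,\gamma,\delta$ be real numbers with $\alpha>1$, $\frac1\alpha+\frac1\beta=1$, $\gamma>1$, $\frac1\gamma+\frac1\delta=1$. Put $$A_1=\max_{1\le i\le n}|c_i|^2\sum_{i=1}^n\|y_i\|^2,\qquad A_2=\Big(\sum_{i=1}^n|c_i|^{2\alpha}\Big)^{\frac1\alpha}\Big(\sum_{i=1}^n\|y_i\|^{2\beta}\Big)^{\frac1\beta},\qquad A_3=\sum_{i=1}^n|c_i|^2\,\max_{1\le i\le n}\|y_i\|^2,$$ and $$B_1=\max_{1\le i\ne j\le n}\{|c_ic_j|\}\sum_{1\le i\ne j\le n}|(y_i,y_j)|,$$ $$B_2=\Big[\Big(\sum_{i=1}^n|c_i|^{\gamma}\Big)^2-\sum_{i=1}^n|c_i|^{2\gamma}\Big]^{\frac1\gamma}\Big(\sum_{1\le i\ne j\le n}|(y_i,y_j)|^{\delta}\Big)^{\frac1\delta},$$ $$B_3=\Big[\Big(\sum_{i=1}^n|c_i|\Big)^2-\sum_{i=1}^n|c_i|^2\Big]\max_{1\le i\ne j\le n}|(y_i,y_j)|.$$ Then for all $k,l\in\{1,2,3\}$ (nine inequalities in total), $$\Big|\sum_{i=1}^n c_i(x,y_i)\Big|^2\le\|x\|^2A_k+\|x\|^2B_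l.$$
   Context: The inner product is linear in the first argument and conjugate-linear in the second, and $\|v\|=(v,v)^{1/2}$. Sums and maxima over $1\le i\ne j\le n$ range over all ordered pairs $(i,j)\in\{1,\dots,n\}^2$ with $i\neq j$; for $n=1$ such (empty) sums and maxima are read as $0$. *)

theory Defs
  imports "HOL-Analysis.Analysis"
begin

text \<open>Complex counterpart of the class \<open>real_inner\<close>; the inner product is linear in the
  first and conjugate-linear in the second argument. By \<open>commute\<close> the value \<open>cinner x x\<close> is real,
  so taking \<open>Re\<close> below loses nothing. Completeness is not required.\<close>

locale complex_inner_space = vector_space scale
  for scale :: "complex \<Rightarrow> 'a::ab_group_add \<Rightarrow> 'a" +
  fixes cinner :: "'a \<Rightarrow> 'a \<Rightarrow> complex"
  assumes commute: "cinner x y = cnj (cinner y x)"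
    and add_left: "cinner (x + y) z = cinner x z + cinner y z"
    and scale_left: "cinner (scale a x) y = a * cinner x y"
    and ge_zero: "0 \<le> Re (cinner x x)"
    and eq_zero_iff: "cinner x x = 0 \<longleftrightarrow> x = 0"

definition cinner_norm :: "('a \<Rightarrow> 'a \<Rightarrow> complex) \<Rightarrow> 'a \<Rightarrow> real" where
  "cinner_norm cinner x = sqrt (Re (cinner x x))"

lemma complex_inner_space_complex: "complex_inner_space (*) (\<lambda>x y::complex. x * cnj y)"
  by unfold_locales
    (auto simp: algebra_simps complex_eq_iff)

definition offdiag :: "nat \<Rightarrow> (nat \<times> nat) set" where
  "offdiag n = {(i, j). i \<in> {1..n} \<and> j \<in> {1..n} \<and> i \<noteq> j}"

text \<open>\<open>Max {}\<close> is unspecified, whereas here the maximum over an empty index set (the case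
  \<open>n = 1\<close>) has to be \<open>0\<close>.\<close>

definition max_offdiag :: "nat \<Rightarrow> (nat \<Rightarrow> nat \<Rightarrow> real) \<Rightarrow> real" where
  "max_offdiag n f = (if offdiag n = {} then 0 else MAX (i, j) \<in> offdiag n. f i j)"

text \<open>The scalars \<open>c\<close> and the vectors \<open>y\<close> are indexed by \<open>1, \<dots>, n\<close>. The norm \<open>nrm\<close>
  and the inner product \<open>ip\<close> of the space are parameters so that the same expressions serve
  \<open>real_inner\<close> and \<open>complex_inner_space\<close>.\<close>

definition A1 :: "('v \<Rightarrow> real) \<Rightarrow> nat \<Rightarrow> (nat \<Rightarrow> 'k::real_normed_field) \<Rightarrow> (nat \<Rightarrow> 'v) \<Rightarrow> real"
  where
  "A1 nrm n c y = (MAX i\<in>{1..n}. (norm (c i))\<^sup>2) * (\<Sum>i=1..n. (nrm (y i))\<^sup>2)"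

definition A2 ::
  "real \<Rightarrow> real \<Rightarrow> ('v \<Rightarrow> real) \<Rightarrow> nat \<Rightarrow> (nat \<Rightarrow> 'k::real_normed_field) \<Rightarrow> (nat \<Rightarrow> 'v) \<Rightarrow> real"
  where
  "A2 \<alpha> \<beta> nrm n c y =
    (\<Sum>i=1..n. norm (c i) powr (2 * \<alpha>)) powr (1 / \<alpha>) *
    (\<Sum>i=1..n. nrm (y i) powr (2 * \<beta>)) powr (1 / \<beta>)"

definition A3 :: "('v \<Rightarrow> real) \<Rightarrow> nat \<Rightarrow> (nat \<Rightarrow> 'k::real_normed_field) \<Rightarrow> (nat \<Rightarrow> 'v) \<Rightarrow> real"
  where
  "A3 nrm n c y = (\<Sum>i=1..n. (norm (c i))\<^sup>2) * (MAX i\<in>{1..n}. (nrm (y i))\<^sup>2)"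

definition B1 :: "('v \<Rightarrow> 'v \<Rightarrow> 'k::real_normed_field) \<Rightarrow> nat \<Rightarrow> (nat \<Rightarrow> 'k) \<Rightarrow> (nat \<Rightarrow> 'v) \<Rightarrow> real"
  where
  "B1 ip n c y =
    max_offdiag n (\<lambda>i j. norm (c i * c j)) * (\<Sum>(i, j)\<in>offdiag n. norm (ip (y i) (y j)))"

definition B2 ::
  "real \<Rightarrow> real \<Rightarrow> ('v \<Rightarrow> 'v \<Rightarrow> 'k::real_normed_field) \<Rightarrow> nat \<Rightarrow> (nat \<Rightarrow> 'k) \<Rightarrow> (nat \<Rightarrow> 'v) \<Rightarrow> real"
  where
  "B2 \<gamma> \<delta> ip n c y =
    ((\<Sum>i=1..n. norm (c i) powr \<gamma>)\<^sup>2 - (\<Sum>i=1..n. norm (c i) powr (2 * \<gamma>))) powr (1 / \<gamma>) *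
    (\<Sum>(i, j)\<in>offdiag n. norm (ip (y i) (y j)) powr \<delta>) powr (1 / \<delta>)"

definition B3 :: "('v \<Rightarrow> 'v \<Rightarrow> 'k::real_normed_field) \<Rightarrow> nat \<Rightarrow> (nat \<Rightarrow> 'k) \<Rightarrow> (nat \<Rightarrow> 'v) \<Rightarrow> real"
  where
  "B3 ip n c y =
    ((\<Sum>i=1..n. norm (c i))\<^sup>2 - (\<Sum>i=1..n. (norm (c i))\<^sup>2)) *
    max_offdiag n (\<lambda>i j. norm (ip (y i) (y j)))"

end

theory Submission imports Defs begin

text \<open>The scalar sum is a single inner product, \<open>\<Sum> c\<^sub>i (x, y\<^sub>i) = (x, z)\<close> with
  \<open>z = \<Sum> conj c\<^sub>i y\<^sub>i\<close>, so by Cauchy--Schwarz its square is at most \<open>\<parallel>x\<parallel>\<^sup>2 \<parallel>z\<parallel>\<^sup>2\<close>. Expanding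
  \<open>\<parallel>z\<parallel>\<^sup>2\<close> as a double sum and taking absolute values termwise gives the Bombieri-type bound
  \<open>norm_coeff_sum_le\<close>, in which \<open>\<parallel>z\<parallel>\<^sup>2\<close> is replaced by a diagonal part
  \<open>\<Sum>\<^sub>i |c\<^sub>i|\<^sup>2 \<parallel>y\<^sub>i\<parallel>\<^sup>2\<close> plus an off-diagonal part \<open>\<Sum>\<^sub>i\<^sub>\<noteq>\<^sub>j |c\<^sub>i c\<^sub>j| |(y\<^sub>i, y\<^sub>j)|\<close>.

  Each part is a sum of products of nonnegative reals, and the three choices of \<open>A\<close> and the three
  choices of \<open>B\<close> are its estimates by Hoelder's inequality with exponents \<open>(\<infinity>, 1)\<close>,
  \<open>(p, q)\<close> and \<open>(1, \<infinity>)\<close>. In \<open>B2\<close> and \<open>B3\<close> the power sums of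
  \<open>|c\<^sub>i c\<^sub>j|\<close> over the pairs with \<open>i \<noteq> j\<close> come out in closed form because the sum over all pairs
  is a square. The two parts are estimated
  independently, which is why all nine combinations hold.\<close>


section \<open>Inner products over the real or the complex field\<close>

text \<open>Real and complex inner products are treated at once: \<open>conj\<close> is the identity on the reals
  and complex conjugation on the complex numbers. The norm is a parameter tied to \<open>ip\<close>
  by \<open>ip_self\<close>, so that it can be the type class norm in one case and \<open>cinner_norm\<close> in the other.\<close>

locale inner_product =
  fixes conj :: "'k::real_normed_field \<Rightarrow> 'k"
    and scale :: "'k \<Rightarrow> 'v::ab_group_add \<Rightarrow> 'v"
    and ip :: "'v \<Rightarrow> 'v \<Rightarrow> 'k"
    and nrm :: "'v \<Rightarrow> real"
  assumes conj_add: "conj (a + b) = conj a + conj b"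
    and conj_mult: "conj (a * b) = conj a * conj b"
    and conj_conj: "conj (conj a) = a"
    and conj_of_real: "conj (of_real r) = of_real r"
    and mult_conj: "a * conj a = of_real ((norm a)\<^sup>2)"
    and norm_conj: "norm (conj a) = norm a"
    and commute: "ip u v = conj (ip v u)"
    and add_left: "ip (u + v) w = ip u w + ip v w"
    and scale_left: "ip (scale a u) w = a * ip u w"
    and ip_self: "ip u u = of_real ((nrm u)\<^sup>2)"
    and ip_self_eq_zero: "ip u u = 0 \<Longrightarrow> u = 0"
begin

lemma conj_zero: "conj 0 = 0"
  using conj_of_real[of 0] by simp

lemma conj_minus: "conj (- a) = - conj a"
  using conj_add[of a "- a"] by (simp add: conj_zero eq_neg_iff_add_eq_0 add.commute)

lemma zero_left: "ip 0 w = 0"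
  using add_left[of 0 0 w] by simp

lemma zero_right: "ip w 0 = 0"
  using commute[of w 0] by (simp add: zero_left conj_zero)

lemma add_right: "ip w (u + v) = ip w u + ip w v"
  by (metis add_left commute conj_add)

lemma scale_right: "ip w (scale a u) = conj a * ip w u"
  by (metis commute conj_mult scale_left)

lemma sum_left: "ip (\<Sum>i\<in>I. f i) w = (\<Sum>i\<in>I. ip (f i) w)"
  by (induction I rule: infinite_finite_induct) (simp_all add: zero_left add_left)

lemma sum_right: "ip w (\<Sum>i\<in>I. f i) = (\<Sum>i\<in>I. ip w (f i))"
  by (induction I rule: infinite_finite_induct) (simp_all add: zero_right add_right)

text \<open>The usual projection argument, cleared of denominators: the vector
  \<open>\<parallel>z\<parallel>\<^sup>2 x - (x, z) z\<close> has squared norm \<open>\<parallel>z\<parallel>\<^sup>2 (\<parallel>x\<parallel>\<^sup>2 \<parallel>z\<parallel>\<^sup>2 - |(x, z)|\<^sup>2)\<close>.\<close>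

lemma Cauchy_Schwarz: "(norm (ip x z))\<^sup>2 \<le> (nrm x)\<^sup>2 * (nrm z)\<^sup>2"
proof (cases "nrm z = 0")
  case True
  then have "z = 0"
    using ip_self[of z] by (intro ip_self_eq_zero) simp
  then show ?thesis
    by (simp add: zero_right)
next
  case False
  define N X t where "N = (nrm z)\<^sup>2" and "X = (nrm x)\<^sup>2" and "t = ip x z"
  define w where "w = scale (of_real N) x + scale (- t) z"
  have "ip w w = of_real N * of_real N * of_real X - of_real N * (t * conj t)"
    unfolding w_def add_left add_right scale_left scale_right conj_of_real conj_minus
    by (simp add: ip_self commute[of z x] algebra_simps flip: t_def N_def X_def)
  then have "of_real ((nrm w)\<^sup>2) = (of_real (N * (X * N - (norm t)\<^sup>2)) :: 'k)"
    unfolding mult_conj ip_self by (simp add: algebra_simps)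
  then have "(nrm w)\<^sup>2 = N * (X * N - (norm t)\<^sup>2)"
    by (simp only: of_real_eq_iff)
  then have "0 \<le> N * (X * N - (norm t)\<^sup>2)"
    by (metis zero_le_power2)
  moreover have "N > 0"
    using False by (simp add: N_def)
  ultimately show ?thesis
    by (simp add: zero_le_mult_iff N_def X_def t_def)
qed

text \<open>The vector \<open>z\<close> carries conjugated coefficients because \<open>ip\<close> is conjugate-linear in its second
  argument; this makes the given sum equal to \<open>ip x z\<close>. The terms with \<open>i = j\<close> in the expansion of
  \<open>ip z z\<close> are kept apart because there \<open>|(y\<^sub>i, y\<^sub>i)| = \<parallel>y\<^sub>i\<parallel>\<^sup>2\<close>.\<close>

lemma norm_coeff_sum_le:
  assumes "finite I"
  shows "(norm (\<Sum>i\<in>I. c i * ip x (y i)))\<^sup>2 \<le> (nrm x)\<^sup>2 *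
    ((\<Sum>i\<in>I. (norm (c i))\<^sup>2 * (nrm (y i))\<^sup>2) +
     (\<Sum>(i, j)\<in>{(i, j). i \<in> I \<and> j \<in> I \<and> i \<noteq> j}. norm (c i * c j) * norm (ip (y i) (y j))))"
proof -
  define z where "z = (\<Sum>i\<in>I. scale (conj (c i)) (y i))"
  define F where "F = (\<lambda>i j. norm (c i * c j) * norm (ip (y i) (y j)))"
  let ?P = "{(i, j). i \<in> I \<and> j \<in> I \<and> i \<noteq> j}"
  have "?P \<subseteq> I \<times> I"
    by auto
  then have fin: "finite ?P"
    using assms by (meson finite_SigmaI finite_subset)
  have split: "I \<times> I = (\<lambda>i. (i, i)) ` I \<union> ?P"
    by auto
  have "(nrm z)\<^sup>2 = norm (ip z z)"
    by (simp add: ip_self norm_power)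
  also have "ip z z = (\<Sum>i\<in>I. \<Sum>j\<in>I. conj (c i) * c j * ip (y i) (y j))"
    unfolding z_def sum_left
    by (simp add: sum_right scale_left scale_right conj_conj mult_ac)
  also have "norm \<dots> \<le> (\<Sum>i\<in>I. \<Sum>j\<in>I. F i j)"
    by (intro sum_norm_le) (simp add: F_def norm_mult norm_conj)
  also have "\<dots> = (\<Sum>(i, j)\<in>I \<times> I. F i j)"
    by (rule sum.cartesian_product)
  also have "\<dots> = (\<Sum>(i, j)\<in>(\<lambda>i. (i, i)) ` I. F i j) + (\<Sum>(i, j)\<in>?P. F i j)"
    unfolding split by (rule sum.union_disjoint) (use assms fin in auto)
  also have "(\<Sum>(i, j)\<in>(\<lambda>i. (i, i)) ` I. F i j) = (\<Sum>i\<in>I. F i i)"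
    by (simp add: sum.reindex inj_on_def)
  also have "\<dots> = (\<Sum>i\<in>I. (norm (c i))\<^sup>2 * (nrm (y i))\<^sup>2)"
    by (simp add: F_def ip_self norm_mult norm_power power2_eq_square)
  finally have z: "(nrm z)\<^sup>2 \<le> (\<Sum>i\<in>I. (norm (c i))\<^sup>2 * (nrm (y i))\<^sup>2) + (\<Sum>(i, j)\<in>?P. F i j)" .
  have "(\<Sum>i\<in>I. c i * ip x (y i)) = ip x z"
    by (simp add: z_def sum_right scale_right conj_conj)
  then have "(norm (\<Sum>i\<in>I. c i * ip x (y i)))\<^sup>2 \<le> (nrm x)\<^sup>2 * (nrm z)\<^sup>2"
    using Cauchy_Schwarz by simp
  also have "\<dots> \<le> (nrm x)\<^sup>2 *
      ((\<Sum>i\<in>I. (norm (c i))\<^sup>2 * (nrm (y i))\<^sup>2) + (\<Sum>(i, j)\<in>?P. F i j))"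
    by (intro mult_left_mono z) simp
  finally show ?thesis
    unfolding F_def .
qed

end

lemma inner_product_real:
  "inner_product (\<lambda>a. a) scaleR (inner :: 'a::real_inner \<Rightarrow> 'a \<Rightarrow> real) norm"
  by unfold_locales
    (auto simp: inner_commute inner_add_left inner_add_right dot_square_norm power2_eq_square)

lemma inner_product_complex:
  fixes scale :: "complex \<Rightarrow> 'a::ab_group_add \<Rightarrow> 'a"
  assumes "complex_inner_space scale cinner"
  shows "inner_product cnj scale cinner (cinner_norm cinner)"
proof -
  interpret complex_inner_space scale cinner
    by (rule assms)
  have self: "cinner u u = of_real ((cinner_norm cinner u)\<^sup>2)" for u
    using commute[of u u] ge_zero[of u] by (simp add: cinner_norm_def complex_eq_iff)
  show ?thesis
    by unfold_locales
      (rule self complex_norm_square[symmetric]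
        | simp add: add_left scale_left eq_zero_iff flip: commute)+
qed


section \<open>Hoelder's inequality for finite sums\<close>

lemma Holder_sum:
  fixes f g :: "'i \<Rightarrow> real"
  assumes pq: "p > 1" "1 / p + 1 / q = 1"
    and f: "\<And>i. i \<in> S \<Longrightarrow> 0 \<le> f i" and g: "\<And>i. i \<in> S \<Longrightarrow> 0 \<le> g i"
  shows "(\<Sum>i\<in>S. f i * g i) \<le> (\<Sum>i\<in>S. f i powr p) powr (1 / p) * (\<Sum>i\<in>S. g i powr q) powr (1 / q)"
proof (cases "finite S")
  case False
  then show ?thesis by simp
next
  case S: True
  have "1 / q = 1 - 1 / p" "1 / p < 1" "1 / p > 0"
    using pq by auto
  then have "0 < 1 / q" "1 / q < 1"
    by auto
  then have q: "q > 1"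
    by (metis less_divide_eq_1_pos zero_less_divide_1_iff divide_less_eq_1_pos)
  define P Q where "P = (\<Sum>i\<in>S. f i powr p)" and "Q = (\<Sum>i\<in>S. g i powr q)"
  have nonneg: "P \<ge> 0" "Q \<ge> 0"
    unfolding P_def Q_def by (auto intro: sum_nonneg)
  show ?thesis
  proof (cases "P = 0 \<or> Q = 0")
    case True
    then have "(\<Sum>i\<in>S. f i * g i) = 0"
      using S by (auto simp: P_def Q_def sum_nonneg_eq_0_iff)
    then show ?thesis
      by simp
  next
    case False
    then have pos: "P > 0" "Q > 0"
      using nonneg by auto
    define a b where "a = P powr (1 / p)" and "b = Q powr (1 / q)"
    have ab: "a > 0" "b > 0" "a powr p = P" "b powr q = Q"
      using pos pq(1) q by (auto simp: a_def b_def powr_powr)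
    \<comment> \<open>Young's inequality for \<open>f\<close> and \<open>g\<close> normalised to have \<open>p\<close>- and \<open>q\<close>-norm 1\<close>
    have "(\<Sum>i\<in>S. (f i / a) * (g i / b)) \<le> (\<Sum>i\<in>S. (f i / a) powr p / p + (g i / b) powr q / q)"
      by (intro sum_mono Youngs_inequality) (use pq q f g ab in auto)
    also have "\<dots> = (\<Sum>i\<in>S. f i powr p / P / p + g i powr q / Q / q)"
      using f g ab by (intro sum.cong refl) (simp add: powr_divide)
    also have "\<dots> = P / P / p + Q / Q / q"
      by (simp add: sum.distrib P_def Q_def flip: sum_divide_distrib)
    also have "\<dots> = 1"
      using pos pq(2) by simp
    finally have "(\<Sum>i\<in>S. f i * g i) / (a * b) \<le> 1"
      by (simp add: sum_divide_distrib)
    then show ?thesis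
      using ab by (simp add: a_def b_def P_def Q_def divide_le_eq)
  qed
qed

lemma sum_mult_le_bound_mult_sum:
  fixes f g :: "'i \<Rightarrow> real"
  assumes "\<And>i. i \<in> S \<Longrightarrow> f i \<le> M" "\<And>i. i \<in> S \<Longrightarrow> 0 \<le> g i"
  shows "(\<Sum>i\<in>S. f i * g i) \<le> M * (\<Sum>i\<in>S. g i)"
  unfolding sum_distrib_left using assms by (intro sum_mono mult_right_mono)


section \<open>The diagonal part\<close>

lemma diag_le_A1:
  "(\<Sum>i=1..n. (norm (c i))\<^sup>2 * (nrm (y i))\<^sup>2) \<le> A1 nrm n c y"
  unfolding A1_def by (rule sum_mult_le_bound_mult_sum) auto

lemma diag_le_A2:
  assumes "\<alpha> > 1" "1 / \<alpha> + 1 / \<beta> = 1" "\<And>v. 0 \<le> nrm v"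
  shows "(\<Sum>i=1..n. (norm (c i))\<^sup>2 * (nrm (y i))\<^sup>2) \<le> A2 \<alpha> \<beta> nrm n c y"
proof -
  have sq: "(t\<^sup>2) powr r = t powr (2 * r)" if "0 \<le> t" for t r :: real
    using that powr_powr[of t 2 r] by (cases "t = 0") auto
  show ?thesis
    using Holder_sum[OF assms(1,2), of "{1..n}" "\<lambda>i. (norm (c i))\<^sup>2" "\<lambda>i. (nrm (y i))\<^sup>2"] assms(3)
    by (simp add: A2_def sq)
qed

lemma diag_le_A3:
  "(\<Sum>i=1..n. (norm (c i))\<^sup>2 * (nrm (y i))\<^sup>2) \<le> A3 nrm n c y"
  unfolding A3_def
  using sum_mult_le_bound_mult_sum[of "{1..n}" "\<lambda>i. (nrm (y i))\<^sup>2" "MAX i\<in>{1..n}. (nrm (y i))\<^sup>2"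
      "\<lambda>i. (norm (c i))\<^sup>2"]
  by (simp add: mult.commute)


section \<open>The off-diagonal part\<close>

lemma finite_offdiag: "finite (offdiag n)"
  by (rule finite_subset[of _ "{1..n} \<times> {1..n}"]) (auto simp: offdiag_def)

lemma le_max_offdiag:
  assumes "(i, j) \<in> offdiag n"
  shows "f i j \<le> max_offdiag n f"
proof -
  have "(\<lambda>(i, j). f i j) (i, j) \<le> (MAX (i, j)\<in>offdiag n. f i j)"
    using assms finite_offdiag by (intro Max_ge imageI finite_imageI)
  then show ?thesis
    using assms by (auto simp: max_offdiag_def)
qed

text \<open>The pairs with \<open>i \<noteq> j\<close> are all pairs except those with \<open>i = j\<close>; this is where the brackets in
  \<open>B2\<close> and \<open>B3\<close> come from.\<close>

lemma sum_offdiag_mult: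
  fixes h :: "nat \<Rightarrow> real"
  shows "(\<Sum>(i, j)\<in>offdiag n. h i * h j) = (\<Sum>i=1..n. h i)\<^sup>2 - (\<Sum>i=1..n. (h i)\<^sup>2)"
proof -
  have split: "{1..n} \<times> {1..n} = (\<lambda>i. (i, i)) ` {1..n} \<union> offdiag n"
    by (auto simp: offdiag_def)
  have "(\<Sum>i=1..n. h i)\<^sup>2 = (\<Sum>(i, j)\<in>{1..n} \<times> {1..n}. h i * h j)"
    by (simp add: power2_eq_square sum_product sum.cartesian_product)
  also have "\<dots> = (\<Sum>(i, j)\<in>(\<lambda>i. (i, i)) ` {1..n}. h i * h j) + (\<Sum>(i, j)\<in>offdiag n. h i * h j)"
    unfolding split
    by (rule sum.union_disjoint) (simp_all add: finite_offdiag, auto simp: offdiag_def)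
  also have "(\<Sum>(i, j)\<in>(\<lambda>i. (i, i)) ` {1..n}. h i * h j) = (\<Sum>i=1..n. (h i)\<^sup>2)"
    by (simp add: sum.reindex inj_on_def power2_eq_square)
  finally show ?thesis
    by simp
qed

lemma offdiag_le_B1:
  "(\<Sum>(i, j)\<in>offdiag n. norm (c i * c j) * norm (ip (y i) (y j))) \<le> B1 ip n c y"
  unfolding B1_def case_prod_unfold
  by (rule sum_mult_le_bound_mult_sum)
    (auto intro: le_max_offdiag[where f = "\<lambda>i j. norm (c i * c j)"])

lemma offdiag_le_B2:
  assumes "\<gamma> > 1" "1 / \<gamma> + 1 / \<delta> = 1"
  shows "(\<Sum>(i, j)\<in>offdiag n. norm (c i * c j) * norm (ip (y i) (y j))) \<le> B2 \<gamma> \<delta> ip n c y"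
proof -
  have "(\<Sum>(i, j)\<in>offdiag n. norm (c i * c j) powr \<gamma>) =
      (\<Sum>(i, j)\<in>offdiag n. norm (c i) powr \<gamma> * norm (c j) powr \<gamma>)"
    by (simp add: norm_mult powr_mult)
  also have "\<dots> = (\<Sum>i=1..n. norm (c i) powr \<gamma>)\<^sup>2 - (\<Sum>i=1..n. norm (c i) powr (2 * \<gamma>))"
  proof -
    have "(norm (c i) powr \<gamma>)\<^sup>2 = norm (c i) powr (2 * \<gamma>)" for i
      by (simp only: power2_eq_square mult_2 powr_add)
    then show ?thesis
      by (simp add: sum_offdiag_mult)
  qed
  finally show ?thesis
    using Holder_sum[OF assms, of "offdiag n" "\<lambda>(i, j). norm (c i * c j)"
        "\<lambda>(i, j). norm (ip (y i) (y j))"]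
    by (simp add: B2_def case_prod_unfold)
qed

lemma offdiag_le_B3:
  "(\<Sum>(i, j)\<in>offdiag n. norm (c i * c j) * norm (ip (y i) (y j))) \<le> B3 ip n c y"
proof -
  let ?M = "max_offdiag n (\<lambda>i j. norm (ip (y i) (y j)))"
  have "(\<Sum>(i, j)\<in>offdiag n. norm (ip (y i) (y j)) * norm (c i * c j)) \<le>
      ?M * (\<Sum>(i, j)\<in>offdiag n. norm (c i * c j))"
    unfolding case_prod_unfold
    by (rule sum_mult_le_bound_mult_sum)
      (auto intro: le_max_offdiag[where f = "\<lambda>i j. norm (ip (y i) (y j))"])
  also have "(\<Sum>(i, j)\<in>offdiag n. norm (c i * c j)) =
      (\<Sum>i=1..n. norm (c i))\<^sup>2 - (\<Sum>i=1..n. (norm (c i))\<^sup>2)"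
    by (simp add: norm_mult sum_offdiag_mult)
  finally show ?thesis
    by (simp add: B3_def mult.commute)
qed


section \<open>The nine inequalities\<close>

lemma (in inner_product) norm_coeff_sum_le_A_B:
  assumes "\<alpha> > 1" "1 / \<alpha> + 1 / \<beta> = 1" "\<gamma> > 1" "1 / \<gamma> + 1 / \<delta> = 1"
    and nrm: "\<And>v. 0 \<le> nrm v"
    and A: "A \<in> {A1 nrm n c y, A2 \<alpha> \<beta> nrm n c y, A3 nrm n c y}"
    and B: "B \<in> {B1 ip n c y, B2 \<gamma> \<delta> ip n c y, B3 ip n c y}"
  shows "(norm (\<Sum>i=1..n. c i * ip x (y i)))\<^sup>2 \<le> (nrm x)\<^sup>2 * A + (nrm x)\<^sup>2 * B"
proof -
  let ?D = "\<Sum>i=1..n. (norm (c i))\<^sup>2 * (nrm (y i))\<^sup>2"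
  let ?E = "\<Sum>(i, j)\<in>offdiag n. norm (c i * c j) * norm (ip (y i) (y j))"
  have "?D \<le> A"
    using A diag_le_A1 diag_le_A2[where nrm = nrm, OF assms(1,2) nrm] diag_le_A3 by blast
  moreover have "?E \<le> B"
    using B offdiag_le_B1 offdiag_le_B2[OF assms(3,4)] offdiag_le_B3 by blast
  ultimately have "(nrm x)\<^sup>2 * (?D + ?E) \<le> (nrm x)\<^sup>2 * (A + B)"
    by (intro mult_left_mono add_mono) auto
  with norm_coeff_sum_le[of "{1..n}" c x y] show ?thesis
    by (simp add: offdiag_def algebra_simps)
qed

theorem theorem3:
  fixes n :: nat and \<alpha> \<beta> \<gamma> \<delta> :: real
  assumes "n \<ge> 1"
    and "\<alpha> > 1" and "1 / \<alpha> + 1 / \<beta> = 1"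
    and "\<gamma> > 1" and "1 / \<gamma> + 1 / \<delta> = 1"
  shows
    "(\<forall>(x::'a::real_inner) (y::nat \<Rightarrow> 'a) (c::nat \<Rightarrow> real).
        \<forall>A \<in> {A1 norm n c y, A2 \<alpha> \<beta> norm n c y, A3 norm n c y}.
        \<forall>B \<in> {B1 inner n c y, B2 \<gamma> \<delta> inner n c y, B3 inner n c y}.
          \<bar>\<Sum>i=1..n. c i * inner x (y i)\<bar>\<^sup>2 \<le> (norm x)\<^sup>2 * A + (norm x)\<^sup>2 * B)
     \<and>
     (\<forall>(scale :: complex \<Rightarrow> 'b::ab_group_add \<Rightarrow> 'b) (cinner :: 'b \<Rightarrow> 'b \<Rightarrow> complex).
        complex_inner_space scale cinner \<longrightarrow>
        (\<forall>(x::'b) (y::nat \<Rightarrow> 'b) (c::nat \<Rightarrow> complex).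
          \<forall>A \<in> {A1 (cinner_norm cinner) n c y, A2 \<alpha> \<beta> (cinner_norm cinner) n c y,
                 A3 (cinner_norm cinner) n c y}.
          \<forall>B \<in> {B1 cinner n c y, B2 \<gamma> \<delta> cinner n c y, B3 cinner n c y}.
            (cmod (\<Sum>i=1..n. c i * cinner x (y i)))\<^sup>2
              \<le> (cinner_norm cinner x)\<^sup>2 * A + (cinner_norm cinner x)\<^sup>2 * B))"
proof (intro conjI allI ballI impI)
  fix x :: 'a and y :: "nat \<Rightarrow> 'a" and c :: "nat \<Rightarrow> real" and A B
  assume "A \<in> {A1 norm n c y, A2 \<alpha> \<beta> norm n c y, A3 norm n c y}"
    and "B \<in> {B1 inner n c y, B2 \<gamma> \<delta> inner n c y, B3 inner n c y}"
  from inner_product.norm_coeff_sum_le_A_B[OF inner_product_real assms(2-) _ this, of x]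
  show "\<bar>\<Sum>i=1..n. c i * inner x (y i)\<bar>\<^sup>2 \<le> (norm x)\<^sup>2 * A + (norm x)\<^sup>2 * B"
    by simp
next
  fix scale :: "complex \<Rightarrow> 'b \<Rightarrow> 'b" and cinner :: "'b \<Rightarrow> 'b \<Rightarrow> complex"
    and x :: 'b and y :: "nat \<Rightarrow> 'b" and c :: "nat \<Rightarrow> complex" and A B
  assume space: "complex_inner_space scale cinner"
    and AB: "A \<in> {A1 (cinner_norm cinner) n c y, A2 \<alpha> \<beta> (cinner_norm cinner) n c y,
        A3 (cinner_norm cinner) n c y}"
      "B \<in> {B1 cinner n c y, B2 \<gamma> \<delta> cinner n c y, B3 cinner n c y}"
  have "0 \<le> cinner_norm cinner v" for v
    using complex_inner_space.ge_zero[OF space] by (simp add: cinner_norm_def)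
  from inner_product.norm_coeff_sum_le_A_B[OF inner_product_complex[OF space] assms(2-) this AB]
  show "(cmod (\<Sum>i=1..n. c i * cinner x (y i)))\<^sup>2
      \<le> (cinner_norm cinner x)\<^sup>2 * A + (cinner_norm cinner x)\<^sup>2 * B" .
qed

end
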